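(* Let $\mathcal{H}$ be a separable Hilbert space. Assume that the infinite matrix $E=(E_{n,k})_{n,k\geq1}$ defines a matrix mapping on $\bigoplus_{n=1}^\infty\mathcal{H}$, and let $\bar{E}=(\overline{E_{n,k}})_{n,k\geq1}$ be the entrywise complex conjugate matrix. Then $\bar{E}$ also defines a matrix mapping on $\bigoplus_{n=1}^\infty\mathcal{H}$. If $E$ is an invertible matrix, then $\bar{E}$ is invertible. If $E$ is a surjective matrix mapping on $\bigoplus_{n=1}^\infty\mathcal{H}$, then $\bar{E}$ acts surjectively on $\bigoplus_{n=1}^\infty\mathcal{H}$.
   Context: Matrices have real or complex entries (scalars of the Hilbert space). $\bigoplus_{n=1}^\infty\mathcal{H}$ is the Hilbert space of sequences $\{f_n\}_{n=1}^\infty$ in $\mathcal{H}$ with $\sum_n\|f_n\|^2<\infty$. For an infinite matrix $E$ and a sequence $x=\{x_k\}$, $Ex=\{\sum_{k=1}^\infty E_{n,k}x_k\}_{n=1}^\infty$. $E$ defines a matrix mapping on a sequence space $\mathcal X$ if for every $x\in\mathcal X$ all these series converge and $Ex\in\mathcal X$; it is surjective if $x\mapsto Ex$ maps $\mathcal X$ onto $\mathcal X$. $E$ is invertible if there is an infinite matrix $E^{-1}$ with $EE^{-1}=E^{-1}E=I$ (algebraic inverse; entries of the products given by convergent series, $I$ the infinite identity matrix). *)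

theory Defs
  imports "HOL-Analysis.Analysis"
begin

text \<open>
  The scalars of a Hilbert space are the reals or the complex numbers. Both are captured by one
  type class: a real normed field together with an isometric embedding into the complex numbers
  whose range is closed under conjugation. By \<open>range_to_complex\<close> below the range is either the
  real line or the whole complex plane.
\<close>

class real_or_complex = real_normed_field +
  fixes to_complex :: "'a \<Rightarrow> complex"
    and sconj :: "'a \<Rightarrow> 'a"
  assumes to_complex_add: "to_complex (x + y) = to_complex x + to_complex y"
    and to_complex_mult: "to_complex (x * y) = to_complex x * to_complex y"
    and to_complex_scaleR: "to_complex (scaleR r x) = scaleR r (to_complex x)"
    and norm_to_complex: "cmod (to_complex x) = norm x"
    and to_complex_sconj: "to_complex (sconj x) = cnj (to_complex x)"

instantiation real :: real_or_complex
begin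
definition to_complex_real :: "real \<Rightarrow> complex" where "to_complex_real = complex_of_real"
definition sconj_real :: "real \<Rightarrow> real" where "sconj_real x = x"
instance
  by standard (simp_all add: to_complex_real_def sconj_real_def scaleR_conv_of_real)
end

instantiation complex :: real_or_complex
begin
definition to_complex_complex :: "complex \<Rightarrow> complex" where "to_complex_complex z = z"
definition sconj_complex :: "complex \<Rightarrow> complex" where "sconj_complex = cnj"
instance
  by standard (simp_all add: to_complex_complex_def sconj_complex_def)
end

lemma to_complex_of_real:
  "to_complex (of_real r :: 'k::real_or_complex) = complex_of_real r"
proof -
  let ?u = "to_complex (1::'k)"
  have "?u * ?u = ?u"
    using to_complex_mult[of "1::'k" 1] by simp
  moreover have "?u \<noteq> 0"
    using norm_to_complex[of "1::'k"] by auto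
  ultimately have "?u = 1" by simp
  then show ?thesis
    by (simp add: of_real_def to_complex_scaleR)
qed

lemma range_to_complex:
  "range (to_complex :: 'k::real_or_complex \<Rightarrow> complex) = \<real> \<or>
   range (to_complex :: 'k \<Rightarrow> complex) = UNIV"
proof (cases "range (to_complex :: 'k \<Rightarrow> complex) \<subseteq> \<real>")
  case True
  have "\<real> \<subseteq> range (to_complex :: 'k \<Rightarrow> complex)"
    by (metis (no_types, lifting) Reals_cases rangeI subsetI to_complex_of_real)
  with True show ?thesis by blast
next
  case False
  then obtain x :: 'k where x: "Im (to_complex x) \<noteq> 0"
    using complex_is_Real_iff by auto
  have "z \<in> range (to_complex :: 'k \<Rightarrow> complex)" for z
  proof -
    define b where "b = Im z / Im (to_complex x)"
    define a where "a = Re z - b * Re (to_complex x)"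
    have "to_complex (of_real a + scaleR b x) = z"
      using x by (simp add: to_complex_add to_complex_scaleR to_complex_of_real complex_eq_iff
          a_def b_def del: of_real_diff of_real_mult of_real_divide)
    then show ?thesis by (metis rangeI)
  qed
  then show ?thesis by blast
qed

text \<open>
  A Hilbert space over the scalar field \<open>'k\<close>: completeness and the norm come from the type class
  \<open>banach\<close> of \<open>'h\<close>; the inner product is linear in its first argument.
\<close>

locale hilbert_space = vector_space smul
  for smul :: "'k::real_or_complex \<Rightarrow> 'h::banach \<Rightarrow> 'h" +
  fixes ip :: "'h \<Rightarrow> 'h \<Rightarrow> 'k"
  assumes scale_of_real: "smul (of_real r) x = scaleR r x"
    and ip_add_left: "ip (x + y) z = ip x z + ip y z"
    and ip_scale_left: "ip (smul a x) y = a * ip x y"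
    and ip_commute: "ip y x = sconj (ip x y)"
    and ip_self: "ip x x = of_real ((norm x)\<^sup>2)"

lemma hilbert_space_real:
  "hilbert_space scaleR (inner :: 'h::{real_inner, banach} \<Rightarrow> 'h \<Rightarrow> real)"
  by unfold_locales
    (simp_all add: sconj_real_def inner_add_left inner_commute power2_norm_eq_inner algebra_simps)

lemma hilbert_space_complex: "hilbert_space (*) (\<lambda>z w :: complex. z * cnj w)"
  by unfold_locales
    (simp_all add: sconj_complex_def scaleR_conv_of_real complex_norm_square[symmetric] algebra_simps
        del: of_real_power)

text \<open>Sequences and infinite matrices are indexed by \<open>nat\<close>, starting at 0 instead of 1.\<close>

type_synonym 'k inf_matrix = "nat \<Rightarrow> nat \<Rightarrow> 'k"

definition l2_sum :: "(nat \<Rightarrow> 'h::real_normed_vector) set" where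
  "l2_sum = {f. summable (\<lambda>n. (norm (f n))\<^sup>2)}"

definition matrix_apply ::
  "('k \<Rightarrow> 'h \<Rightarrow> 'h::real_normed_vector) \<Rightarrow> 'k inf_matrix \<Rightarrow> (nat \<Rightarrow> 'h) \<Rightarrow> nat \<Rightarrow> 'h" where
  "matrix_apply smul E x = (\<lambda>n. \<Sum>k. smul (E n k) (x k))"

definition matrix_mapping_on ::
  "('k \<Rightarrow> 'h \<Rightarrow> 'h::real_normed_vector) \<Rightarrow> (nat \<Rightarrow> 'h) set \<Rightarrow> 'k inf_matrix \<Rightarrow> bool" where
  "matrix_mapping_on smul X E \<longleftrightarrow>
     (\<forall>x\<in>X. (\<forall>n. summable (\<lambda>k. smul (E n k) (x k))) \<and> matrix_apply smul E x \<in> X)"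

definition surjective_matrix_mapping_on ::
  "('k \<Rightarrow> 'h \<Rightarrow> 'h::real_normed_vector) \<Rightarrow> (nat \<Rightarrow> 'h) set \<Rightarrow> 'k inf_matrix \<Rightarrow> bool" where
  "surjective_matrix_mapping_on smul X E \<longleftrightarrow>
     matrix_mapping_on smul X E \<and> matrix_apply smul E ` X = X"

definition id_matrix :: "'k::zero_neq_one inf_matrix" where
  "id_matrix = (\<lambda>n m. if n = m then 1 else 0)"

text \<open>\<open>A B = C\<close>, including the convergence of the series defining the entries of \<open>A B\<close>.\<close>

definition is_matrix_product ::
  "'k::real_normed_field inf_matrix \<Rightarrow> 'k inf_matrix \<Rightarrow> 'k inf_matrix \<Rightarrow> bool" where
  "is_matrix_product A B C \<longleftrightarrow> (\<forall>n m. (\<lambda>k. A n k * B k m) sums C n m)"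

definition invertible_matrix :: "'k::real_normed_field inf_matrix \<Rightarrow> bool" where
  "invertible_matrix E \<longleftrightarrow>
     (\<exists>F. is_matrix_product E F id_matrix \<and> is_matrix_product F E id_matrix)"

definition conj_matrix :: "'k::real_or_complex inf_matrix \<Rightarrow> 'k inf_matrix" where
  "conj_matrix E = (\<lambda>n k. sconj (E n k))"

end

theory Submission
  imports Defs
begin

text \<open>
  Everything follows from a conjugation of the Hilbert space: an additive isometric involution
  \<open>J\<close> with \<open>J (a x) = sconj a (J x)\<close>. Applying \<open>J\<close> in every coordinate preserves \<open>l2_sum\<close>, and
  since \<open>sconj a y = J (a (J y))\<close> and \<open>J\<close> commutes with convergent series, the action of the
  conjugate matrix is \<open>J \<circ> E \<circ> J\<close>. Hence the conjugate matrix is a matrix mapping, and a surjective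
  one, whenever \<open>E\<close> is. Invertibility concerns scalar series only: conjugating the entries of an
  inverse of \<open>E\<close> gives an inverse of the conjugate matrix.

  Over the reals \<open>J\<close> is the identity. Over the complex numbers, \<open>J\<close> is usually obtained by conjugating
  coordinates in an orthonormal basis. Here it arises more directly. By Zorn's lemma there is a
  maximal set \<open>V\<close> on which the inner product takes only real values (\<open>maximal_real_subset\<close>).
  Maximality says that \<open>V\<close> consists of exactly the vectors whose inner products with all of \<open>V\<close> are
  real, so \<open>V\<close> is a closed real subspace. A vector \<open>z\<close> is orthogonal to \<open>V\<close> for the real part of the
  inner product iff \<open>i z\<close> has real inner products with \<open>V\<close>, that is, iff \<open>i z\<close> lies in \<open>V\<close>. So
  multiplication by \<open>i\<close> exchanges \<open>V\<close> with its real orthogonal complement, and the reflection in \<open>V\<close>,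
  which exists by the projection theorem, anticommutes with \<open>i\<close>: it is the conjugation sought.
\<close>

section \<open>Conjugation of scalars\<close>

lemma to_complex_zero [simp]: "to_complex (0 :: 'k::real_or_complex) = 0"
  using norm_to_complex[of "0::'k"] by simp

lemma to_complex_one [simp]: "to_complex (1 :: 'k::real_or_complex) = 1"
  using to_complex_of_real[of 1, where 'k = 'k] by simp

lemma to_complex_minus: "to_complex (- x :: 'k::real_or_complex) = - to_complex x"
  using to_complex_add[of x "- x"] by (simp add: add_eq_0_iff)

lemma to_complex_diff: "to_complex (x - y :: 'k::real_or_complex) = to_complex x - to_complex y"
  using to_complex_add[of x "- y"] by (simp add: to_complex_minus)

lemma to_complex_eqI:
  "to_complex (x :: 'k::real_or_complex) = to_complex y \<Longrightarrow> x = y"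
  using norm_to_complex[of "x - y"] by (simp add: to_complex_diff)

lemma sconj_add: "sconj (x + y :: 'k::real_or_complex) = sconj x + sconj y"
  by (rule to_complex_eqI) (simp add: to_complex_add to_complex_sconj)

lemma sconj_mult: "sconj (x * y :: 'k::real_or_complex) = sconj x * sconj y"
  by (rule to_complex_eqI) (simp add: to_complex_mult to_complex_sconj)

lemma sconj_scaleR: "sconj (r *\<^sub>R x :: 'k::real_or_complex) = r *\<^sub>R sconj x"
  by (rule to_complex_eqI) (simp add: to_complex_scaleR to_complex_sconj)

lemma sconj_zero [simp]: "sconj (0 :: 'k::real_or_complex) = 0"
  by (rule to_complex_eqI) (simp add: to_complex_sconj)

lemma sconj_one [simp]: "sconj (1 :: 'k::real_or_complex) = 1"
  by (rule to_complex_eqI) (simp add: to_complex_sconj)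

lemma norm_sconj: "norm (sconj x :: 'k::real_or_complex) = norm x"
  by (metis norm_to_complex to_complex_sconj complex_mod_cnj)

lemma bounded_linear_sconj: "bounded_linear (sconj :: 'k::real_or_complex \<Rightarrow> 'k)"
  by (rule bounded_linear_intro[where K = 1]) (simp_all add: sconj_add sconj_scaleR norm_sconj)

text \<open>Conjugation of scalars is isometric, so it may be applied termwise to the convergent series.\<close>

lemma is_matrix_product_conj:
  assumes "is_matrix_product A B C"
  shows "is_matrix_product (conj_matrix A) (conj_matrix B) (conj_matrix C)"
  unfolding is_matrix_product_def
proof (intro allI)
  fix n m
  have "(\<lambda>k. A n k * B k m) sums C n m"
    using assms by (simp add: is_matrix_product_def)
  from bounded_linear.sums[OF bounded_linear_sconj this]
  show "(\<lambda>k. conj_matrix A n k * conj_matrix B k m) sums conj_matrix C n m"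
    by (simp add: conj_matrix_def sconj_mult)
qed

lemma conj_id_matrix: "conj_matrix (id_matrix :: 'k::real_or_complex inf_matrix) = id_matrix"
  by (auto simp: conj_matrix_def id_matrix_def fun_eq_iff)

lemma invertible_conj_matrix:
  "invertible_matrix E \<Longrightarrow> invertible_matrix (conj_matrix E)"
  unfolding invertible_matrix_def by (metis is_matrix_product_conj conj_id_matrix)

section \<open>Orthogonal projection onto a closed real subspace\<close>

context hilbert_space
begin

definition re_ip :: "'h \<Rightarrow> 'h \<Rightarrow> real" where
  "re_ip x y = Re (to_complex (ip x y))"

definition im_ip :: "'h \<Rightarrow> 'h \<Rightarrow> real" where
  "im_ip x y = Im (to_complex (ip x y))"

lemma ip_scaleR_left: "ip (r *\<^sub>R x) y = r *\<^sub>R ip x y"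
  using ip_scale_left[of "of_real r" x y] by (simp add: scale_of_real scaleR_conv_of_real)

lemma re_ip_commute: "re_ip y x = re_ip x y"
  using ip_commute[of x y] by (simp add: re_ip_def to_complex_sconj)

lemma im_ip_commute: "im_ip y x = - im_ip x y"
  using ip_commute[of x y] by (simp add: im_ip_def to_complex_sconj)

lemma re_ip_add_left: "re_ip (x + y) z = re_ip x z + re_ip y z"
  by (simp add: re_ip_def ip_add_left to_complex_add)

lemma im_ip_add_left: "im_ip (x + y) z = im_ip x z + im_ip y z"
  by (simp add: im_ip_def ip_add_left to_complex_add)

lemma re_ip_scaleR_left: "re_ip (r *\<^sub>R x) y = r * re_ip x y"
  by (simp add: re_ip_def ip_scaleR_left to_complex_scaleR)

lemma im_ip_scaleR_left: "im_ip (r *\<^sub>R x) y = r * im_ip x y"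
  by (simp add: im_ip_def ip_scaleR_left to_complex_scaleR)

lemma re_ip_diff_left: "re_ip (x - y) z = re_ip x z - re_ip y z"
  using re_ip_add_left[of x "(-1) *\<^sub>R y" z] re_ip_scaleR_left[of "-1" y z] by simp

lemma re_ip_add_right: "re_ip z (x + y) = re_ip z x + re_ip z y"
  by (metis re_ip_commute re_ip_add_left)

lemma re_ip_diff_right: "re_ip z (x - y) = re_ip z x - re_ip z y"
  by (metis re_ip_commute re_ip_diff_left)

lemma re_ip_scaleR_right: "re_ip x (r *\<^sub>R y) = r * re_ip x y"
  by (metis re_ip_commute re_ip_scaleR_left)

lemma re_ip_self: "re_ip x x = (norm x)\<^sup>2"
  by (simp add: re_ip_def ip_self to_complex_of_real del: of_real_power)

lemma im_ip_self: "im_ip x x = 0"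
  by (simp add: im_ip_def ip_self to_complex_of_real del: of_real_power)

lemma norm_add_sq: "(norm (x + y))\<^sup>2 = (norm x)\<^sup>2 + 2 * re_ip x y + (norm y)\<^sup>2"
  by (simp flip: re_ip_self add: re_ip_add_left re_ip_add_right re_ip_commute[of x y])

lemma norm_diff_sq: "(norm (x - y))\<^sup>2 = (norm x)\<^sup>2 - 2 * re_ip x y + (norm y)\<^sup>2"
  by (simp flip: re_ip_self add: re_ip_diff_left re_ip_diff_right re_ip_commute[of x y])

text \<open>
  The projection theorem for the real inner product \<open>re_ip\<close>. The sets \<open>S n\<close> of nearly closest points
  of \<open>V\<close> are closed, nested and, by the parallelogram law, of diameter tending to zero; their common
  point \<open>p\<close> is closest to \<open>x\<close>. Minimality along the line through \<open>p\<close> in direction \<open>v\<close> is orthogonality.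
\<close>

lemma orthogonal_projection_exists:
  assumes V: "real_vector.subspace V" "closed V"
  obtains p where "p \<in> V" "\<And>v. v \<in> V \<Longrightarrow> re_ip (x - p) v = 0"
proof -
  define d where "d = (INF v\<in>V. (norm (x - v))\<^sup>2)"
  have V0: "0 \<in> V" using V(1) by (rule real_vector.subspace_0)
  have bdd: "bdd_below ((\<lambda>v. (norm (x - v))\<^sup>2) ` V)"
    by (rule bdd_belowI[of _ 0]) auto
  have d: "d \<le> (norm (x - v))\<^sup>2" if "v \<in> V" for v
    unfolding d_def using bdd that by (rule cINF_lower)
  define S where "S n = V \<inter> {v. (norm (x - v))\<^sup>2 \<le> d + inverse (real (Suc n))}" for n
  have close: "(dist v w)\<^sup>2 \<le> 4 * inverse (real (Suc n))"
    if "v \<in> S n" "w \<in> S n" for v w n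
  proof -
    \<comment> \<open>The midpoint lies in \<open>V\<close>, so its distance from \<open>x\<close> bounds one term of the parallelogram law.\<close>
    let ?m = "(1/2) *\<^sub>R (v + w)"
    have "?m \<in> V"
      using that V(1) by (auto simp: S_def intro: real_vector.subspace_scale real_vector.subspace_add)
    then have "4 * d \<le> 4 * (norm (x - ?m))\<^sup>2" using d by auto
    also have "\<dots> = (norm ((x - v) + (x - w)))\<^sup>2"
    proof -
      have "(x - v) + (x - w) = 2 *\<^sub>R (x - ?m)"
        by (simp add: algebra_simps scaleR_2)
      then show ?thesis by (simp add: power_mult_distrib)
    qed
    finally have "4 * d \<le> (norm ((x - v) + (x - w)))\<^sup>2" .
    moreover have "dist v w = norm ((x - v) - (x - w))"
      by (simp add: dist_norm norm_minus_commute)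
    ultimately show ?thesis
      using that norm_add_sq[of "x - v" "x - w"] norm_diff_sq[of "x - v" "x - w"]
      by (simp add: S_def)
  qed
  obtain p where p: "\<And>n. p \<in> S n"
  proof (rule decreasing_closed_nest)
    show "closed (S n)" for n
      unfolding S_def by (intro closed_Int V(2) closed_Collect_le continuous_intros)
    show "S n \<noteq> {}" for n
    proof -
      have "d < d + inverse (real (Suc n))" by simp
      then obtain v where "v \<in> V" "(norm (x - v))\<^sup>2 < d + inverse (real (Suc n))"
        unfolding d_def using V0 bdd by (subst (asm) cINF_less_iff) auto
      then show ?thesis by (auto simp: S_def)
    qed
    show "S n \<subseteq> S m" if "m \<le> n" for m n
    proof -
      have "inverse (real (Suc n)) \<le> inverse (real (Suc m))"
        using that by (simp add: le_imp_inverse_le)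
      then have "d + inverse (real (Suc n)) \<le> d + inverse (real (Suc m))" by simp
      then show ?thesis unfolding S_def by (blast intro: order_trans)
    qed
    show "\<exists>n. \<forall>v\<in>S n. \<forall>w\<in>S n. dist v w < e" if "e > 0" for e
    proof -
      obtain n where n: "inverse (real (Suc n)) < e\<^sup>2 / 4"
        using reals_Archimedean[of "e\<^sup>2 / 4"] \<open>e > 0\<close> by auto
      have "dist v w < e" if "v \<in> S n" "w \<in> S n" for v w
        by (rule power2_less_imp_less) (use close[OF that] n \<open>e > 0\<close> in auto)
      then show ?thesis by blast
    qed
  qed (rule that)
  have "(norm (x - p))\<^sup>2 \<le> d"
  proof (rule field_le_epsilon)
    fix e :: real assume "e > 0"
    then obtain n where "inverse (real (Suc n)) < e" using reals_Archimedean by blast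
    then show "(norm (x - p))\<^sup>2 \<le> d + e" using p[of n] by (auto simp: S_def)
  qed
  moreover have pV: "p \<in> V" using p by (auto simp: S_def)
  ultimately have min: "(norm (x - p))\<^sup>2 \<le> (norm (x - v))\<^sup>2" if "v \<in> V" for v
    using order_trans[OF _ d[OF that]] by blast
  have "re_ip (x - p) v = 0" if "v \<in> V" for v
  proof (cases "v = 0")
    case True
    then show ?thesis using re_ip_scaleR_right[of "x - p" 0 0] by simp
  next
    case False
    define c where "c = re_ip (x - p) v"
    \<comment> \<open>The minimiser of the quadratic polynomial \<open>t \<mapsto> \<parallel>x - p - t v\<parallel>\<^sup>2\<close>.\<close>
    define t where "t = c / (norm v)\<^sup>2"
    have "p + t *\<^sub>R v \<in> V"
      using V(1) pV that by (simp add: real_vector.subspace_add real_vector.subspace_scale)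
    from min[OF this] have "(norm (x - p))\<^sup>2 \<le> (norm ((x - p) - t *\<^sub>R v))\<^sup>2"
      by (simp add: diff_diff_eq)
    then have "0 \<le> - 2 * t * c + t\<^sup>2 * (norm v)\<^sup>2"
      by (simp add: norm_diff_sq re_ip_scaleR_right c_def power_mult_distrib)
    also have "\<dots> = - (c\<^sup>2 / (norm v)\<^sup>2)"
      using False by (simp add: t_def power2_eq_square field_simps)
    finally have "c\<^sup>2 / (norm v)\<^sup>2 \<le> 0" by simp
    then show ?thesis
      using False by (simp add: c_def divide_le_0_iff)
  qed
  with pV that show thesis by blast
qed


section \<open>A conjugation of the Hilbert space\<close>

lemma continuous_on_re_ip_left: "continuous_on UNIV (\<lambda>z. re_ip z y)"
proof -
  have "re_ip z y = ((norm (z + y))\<^sup>2 - (norm (z - y))\<^sup>2) / 4" for z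
    by (simp add: norm_add_sq norm_diff_sq)
  then have eq: "(\<lambda>z. re_ip z y) = (\<lambda>z. ((norm (z + y))\<^sup>2 - (norm (z - y))\<^sup>2) / 4)"
    by (rule ext)
  show ?thesis unfolding eq by (auto intro!: continuous_intros)
qed

text \<open>
  A set maximal among those on which the inner product is real already contains every vector whose
  inner products with the set are real, because the inner product of a vector with itself is real.
\<close>

lemma maximal_real_subset:
  "\<exists>V. \<forall>z. z \<in> V \<longleftrightarrow> (\<forall>y\<in>V. im_ip z y = 0)"
proof -
  define \<A> where "\<A> = {S. \<forall>x\<in>S. \<forall>y\<in>S. im_ip x y = 0}"
  have "\<exists>V\<in>\<A>. \<forall>X\<in>\<A>. V \<subseteq> X \<longrightarrow> X = V"
  proof (rule subset_Zorn')
    fix C assume C: "subset.chain \<A> C"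
    have "im_ip x y = 0" if "X \<in> C" "Y \<in> C" "x \<in> X" "y \<in> Y" for X Y x y
    proof -
      have "X \<in> \<A>" "Y \<in> \<A>" "X \<subseteq> Y \<or> Y \<subseteq> X"
        using C that by (auto simp: subset_chain_def)
      then show ?thesis using that by (auto simp: \<A>_def)
    qed
    then show "\<Union>C \<in> \<A>" by (auto simp: \<A>_def)
  qed
  then obtain V where V: "V \<in> \<A>" and max: "\<And>X. X \<in> \<A> \<Longrightarrow> V \<subseteq> X \<Longrightarrow> X = V"
    by blast
  have "z \<in> V" if z: "\<forall>y\<in>V. im_ip z y = 0" for z
  proof -
    have "im_ip y z = 0" if "y \<in> V" for y
    proof -
      have "im_ip z y = 0" using z that by blast
      then show ?thesis using im_ip_commute[where x = z and y = y] by simp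
    qed
    then have "insert z V \<in> \<A>"
      using V z by (auto simp: \<A>_def im_ip_self)
    then show ?thesis using max by blast
  qed
  with V have "z \<in> V \<longleftrightarrow> (\<forall>y\<in>V. im_ip z y = 0)" for z
    unfolding \<A>_def by blast
  then show ?thesis by (intro exI allI)
qed

text \<open>
  The conjugation is the reflection in the set \<open>V\<close> of the previous lemma. It is handled through its
  graph \<open>R\<close>, so that each of its algebraic properties becomes a closure property of the real subspace
  \<open>V\<close> combined with the uniqueness of the reflected point.
\<close>

lemma conjugation_exists_of_imaginary_unit:
  assumes i: "to_complex (i::'k) = \<i>"
  obtains J where "\<And>x y. J (x + y) = J x + J y" "\<And>a x. J (smul a x) = smul (sconj a) (J x)"
    "\<And>x. norm (J x) = norm x" "\<And>x. J (J x) = x"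
proof -
  define j where "j = smul i"
  have i_sq: "i * i = -1"
    by (rule to_complex_eqI) (simp add: to_complex_mult to_complex_minus i)
  have jj: "j (j x) = - x" for x by (simp add: j_def i_sq)
  have j_add: "j (x + y) = j x + j y" for x y by (simp add: j_def scale_right_distrib)
  have j_diff: "j (x - y) = j x - j y" for x y by (simp add: j_def scale_right_diff_distrib)
  have j_minus: "j (- x) = - j x" for x by (simp add: j_def)
  have j_scaleR: "j (r *\<^sub>R x) = r *\<^sub>R j x" for r x
    unfolding j_def by (simp flip: scale_of_real add: mult.commute)
  have im_ip_j: "im_ip (j x) y = re_ip x y" for x y
    by (simp add: j_def im_ip_def re_ip_def ip_scale_left to_complex_mult i)
  have re_ip_j: "re_ip (j x) y = - im_ip x y" for x y
    by (simp add: j_def im_ip_def re_ip_def ip_scale_left to_complex_mult i)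
  obtain V where "\<forall>z. z \<in> V \<longleftrightarrow> (\<forall>y\<in>V. im_ip z y = 0)"
    using maximal_real_subset by (rule exE)
  note V = this[THEN spec]
  have im_ip_0: "im_ip 0 y = 0" for y using im_ip_scaleR_left[of 0 0 y] by simp
  have sub: "real_vector.subspace V"
  proof (rule real_vector.subspaceI)
    have VI: "z \<in> V" if "\<And>y. y \<in> V \<Longrightarrow> im_ip z y = 0" for z using V that by blast
    have VD: "im_ip z y = 0" if "z \<in> V" "y \<in> V" for z y using V that by blast
    show "0 \<in> V" by (rule VI) (rule im_ip_0)
    show "z + w \<in> V" if "z \<in> V" "w \<in> V" for z w
      by (rule VI) (simp add: im_ip_add_left VD that)
    show "r *\<^sub>R z \<in> V" if "z \<in> V" for r z
      by (rule VI) (simp add: im_ip_scaleR_left VD that)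
  qed
  \<comment> \<open>\<open>V\<close> is cut out by real orthogonality conditions, which are closed conditions.\<close>
  have "V = (\<Inter>y\<in>V. {z. re_ip z (j y) = 0})"
  proof -
    have "im_ip z y = re_ip z (j y)" for z y
      using re_ip_j[of y z] by (simp add: re_ip_commute[of z] im_ip_commute[of z])
    with V have "z \<in> V \<longleftrightarrow> (\<forall>y\<in>V. re_ip z (j y) = 0)" for z by metis
    then show ?thesis by blast
  qed
  moreover have "closed \<dots>"
    by (intro closed_INT ballI closed_Collect_eq continuous_on_re_ip_left continuous_on_const)
  ultimately have cl: "closed V" by simp
  \<comment> \<open>\<open>y\<close> is the reflection of \<open>x\<close> in \<open>V\<close>: half the sum lies in \<open>V\<close>, half the difference is orthogonal
      to \<open>V\<close>. The latter is expressed by membership of \<open>j (x - y)\<close> in \<open>V\<close>.\<close>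
  define R where "R x y \<longleftrightarrow> x + y \<in> V \<and> j (x - y) \<in> V" for x y
  have R_ex: "\<exists>y. R x y" for x
  proof -
    obtain p where p: "p \<in> V" "\<And>v. v \<in> V \<Longrightarrow> re_ip (x - p) v = 0"
      using orthogonal_projection_exists[OF sub cl] by blast
    then have "j (x - p) \<in> V" by (simp add: V[of "j (x - p)"] im_ip_j)
    then have "2 *\<^sub>R j (x - p) \<in> V" "2 *\<^sub>R p \<in> V"
      using sub p(1) by (auto intro: real_vector.subspace_scale)
    then have "R x (2 *\<^sub>R p - x)"
      by (simp add: R_def scaleR_2 j_diff j_add algebra_simps)
    then show ?thesis ..
  qed
  have R_unique: "y = y'" if "R x y" "R x y'" for x y y'
  proof -
    have "(x + y) - (x + y') \<in> V" "j (x - y') - j (x - y) \<in> V"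
      using that unfolding R_def by (metis sub real_vector.subspace_diff)+
    then have "y - y' \<in> V" "j (y - y') \<in> V" by (simp_all add: j_diff)
    then have "re_ip (y - y') (y - y') = 0" using V im_ip_j by metis
    then show ?thesis by (simp add: re_ip_self)
  qed
  have R_add: "R (x + x') (y + y')" if "R x y" "R x' y'" for x y x' y'
  proof -
    have "(x + y) + (x' + y') \<in> V" "j (x - y) + j (x' - y') \<in> V"
      using that sub by (auto simp: R_def intro: real_vector.subspace_add)
    then show ?thesis by (simp add: R_def j_diff j_add algebra_simps)
  qed
  have R_scaleR: "R (r *\<^sub>R x) (r *\<^sub>R y)" if "R x y" for r x y
  proof -
    have "r *\<^sub>R (x + y) \<in> V" "r *\<^sub>R j (x - y) \<in> V"
      using that sub by (auto simp: R_def intro: real_vector.subspace_scale)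
    then show ?thesis by (simp add: R_def j_diff j_scaleR algebra_simps)
  qed
  have R_sym: "R y x" if "R x y" for x y
  proof -
    have "- j (x - y) \<in> V"
      using that sub by (auto simp: R_def intro: real_vector.subspace_neg)
    then show ?thesis using that by (simp add: R_def j_diff add.commute)
  qed
  have R_j: "R (j x) (- j y)" if "R x y" for x y
  proof -
    have "- (x + y) \<in> V"
      using that unfolding R_def by (metis sub real_vector.subspace_neg)
    then show ?thesis using that by (simp add: R_def j_diff j_add jj)
  qed
  \<comment> \<open>Orthogonality of \<open>x - y\<close> and \<open>x + y\<close> is equality of the norms of \<open>x\<close> and \<open>y\<close>.\<close>
  have R_norm: "norm y = norm x" if "R x y" for x y
  proof -
    have "re_ip (x - y) (x + y) = 0"
      using that V[of "j (x - y)"] by (simp add: R_def im_ip_j)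
    then have "(norm y)\<^sup>2 = (norm x)\<^sup>2"
      by (simp add: re_ip_diff_left re_ip_add_right re_ip_self re_ip_commute[of x y])
    then show ?thesis by simp
  qed
  \<comment> \<open>Real linearity and anticommutation with \<open>j\<close> together give conjugate linearity.\<close>
  have R_smul: "R (smul a x) (smul (sconj a) y)" if "R x y" for a x y
  proof -
    define s t where "s = Re (to_complex a)" and "t = Im (to_complex a)"
    have a: "a = of_real s + of_real t * i"
      by (rule to_complex_eqI)
        (simp add: to_complex_add to_complex_mult to_complex_of_real i s_def t_def complex_eq_iff)
    have sa: "sconj a = of_real s - of_real t * i"
      by (rule to_complex_eqI) (simp add: to_complex_diff to_complex_mult to_complex_of_real
          to_complex_sconj i s_def t_def complex_eq_iff)
    have "smul a x = s *\<^sub>R x + t *\<^sub>R j x"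
      by (simp add: a j_def scale_left_distrib flip: scale_of_real)
    moreover have "smul (sconj a) y = s *\<^sub>R y + t *\<^sub>R (- j y)"
      by (simp add: sa j_def scale_left_diff_distrib flip: scale_of_real)
    ultimately show ?thesis using that by (simp only: R_add R_scaleR R_j)
  qed
  define J where "J x = (SOME y. R x y)" for x
  have J: "R x (J x)" for x unfolding J_def using R_ex by (rule someI_ex)
  show thesis
  proof (rule that[of J])
    show "J (x + y) = J x + J y" for x y by (rule R_unique[OF J R_add[OF J J]])
    show "J (smul a x) = smul (sconj a) (J x)" for a x by (rule R_unique[OF J R_smul[OF J]])
    show "norm (J x) = norm x" for x by (rule R_norm[OF J])
    show "J (J x) = x" for x by (rule R_unique[OF J R_sym[OF J]])
  qed
qed

lemma conjugation_exists:
  obtains J where "bounded_linear J" "\<And>a x. J (smul a x) = smul (sconj a) (J x)"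
    "\<And>x. norm (J x) = norm x" "\<And>x. J (J x) = x"
proof -
  obtain J where J: "\<And>x y. J (x + y) = J x + J y" "\<And>a x. J (smul a x) = smul (sconj a) (J x)"
    "\<And>x. norm (J x) = norm x" "\<And>x. J (J x) = x"
  proof (cases "range (to_complex :: 'k \<Rightarrow> complex) = \<real>")
    case True
    then have "sconj a = a" for a :: 'k
      by (metis to_complex_eqI to_complex_sconj Reals_cnj_iff rangeI)
    then show thesis using that[of "\<lambda>x. x"] by simp
  next
    case False
    then have "range (to_complex :: 'k \<Rightarrow> complex) = UNIV" using range_to_complex by blast
    then obtain i :: 'k where "to_complex i = \<i>" by (metis UNIV_I imageE)
    then show thesis by (rule conjugation_exists_of_imaginary_unit) (rule that)
  qed
  have "J (r *\<^sub>R x) = r *\<^sub>R J x" for r x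
  proof -
    have "sconj (of_real r :: 'k) = of_real r" by (simp add: of_real_def sconj_scaleR)
    then show ?thesis using J(2)[of "of_real r" x] by (simp add: scale_of_real)
  qed
  with J have "bounded_linear J" by (intro bounded_linear_intro[where K = 1]) simp_all
  with J that show thesis by blast
qed

section \<open>The conjugate matrix mapping\<close>

text \<open>
  For a conjugation \<open>J\<close>, the conjugate matrix acts as \<open>J \<circ> E \<circ> J\<close>, because applying \<open>J\<close> termwise to the
  series of \<open>E (J x)\<close> conjugates the matrix entries and undoes the inner \<open>J\<close>.
\<close>

lemma conj_matrix_mapping:
  assumes J: "bounded_linear J" "\<And>a x. J (smul a x) = smul (sconj a) (J x)"
    "\<And>x. norm (J x) = norm x" "\<And>x. J (J x) = x"
    and E: "matrix_mapping_on smul l2_sum E"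
  shows "matrix_mapping_on smul l2_sum (conj_matrix E)"
    and "x \<in> l2_sum \<Longrightarrow> matrix_apply smul (conj_matrix E) x = J \<circ> matrix_apply smul E (J \<circ> x)"
proof -
  have l2: "J \<circ> x \<in> l2_sum" if "x \<in> l2_sum" for x :: "nat \<Rightarrow> 'h"
    using that by (simp add: l2_sum_def J(3))
  have sums: "(\<lambda>k. smul (conj_matrix E n k) (x k)) sums J (matrix_apply smul E (J \<circ> x) n)"
    if "x \<in> l2_sum" for x n
  proof -
    have "summable (\<lambda>k. smul (E n k) (J (x k)))"
      using E l2[OF that] by (force simp: matrix_mapping_on_def)
    then have "(\<lambda>k. smul (E n k) (J (x k))) sums matrix_apply smul E (J \<circ> x) n"
      by (simp add: matrix_apply_def summable_sums)
    from bounded_linear.sums[OF J(1) this] show ?thesis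
      by (simp add: J(2,4) conj_matrix_def)
  qed
  show apply_eq: "matrix_apply smul (conj_matrix E) x = J \<circ> matrix_apply smul E (J \<circ> x)"
    if "x \<in> l2_sum" for x
    using sums_unique[OF sums[OF that]] by (auto simp: matrix_apply_def fun_eq_iff)
  show "matrix_mapping_on smul l2_sum (conj_matrix E)"
    unfolding matrix_mapping_on_def
  proof (intro ballI conjI allI)
    fix x n assume x: "x \<in> (l2_sum :: (nat \<Rightarrow> 'h) set)"
    show "summable (\<lambda>k. smul (conj_matrix E n k) (x k))"
      using sums[OF x] by (rule sums_summable)
    show "matrix_apply smul (conj_matrix E) x \<in> l2_sum"
      using E l2[OF x] by (simp add: apply_eq[OF x] l2 matrix_mapping_on_def)
  qed
qed

text \<open>A preimage of \<open>y\<close> under \<open>J \<circ> E \<circ> J\<close> is \<open>J x\<close>, where \<open>x\<close> is a preimage of \<open>J y\<close> under \<open>E\<close>.\<close>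

lemma surjective_conj_matrix_mapping:
  assumes J: "bounded_linear J" "\<And>a x. J (smul a x) = smul (sconj a) (J x)"
    "\<And>x. norm (J x) = norm x" "\<And>x. J (J x) = x"
    and E: "surjective_matrix_mapping_on smul l2_sum E"
  shows "surjective_matrix_mapping_on smul l2_sum (conj_matrix E)"
proof -
  have l2: "J \<circ> x \<in> l2_sum" if "x \<in> l2_sum" for x :: "nat \<Rightarrow> 'h"
    using that by (simp add: l2_sum_def J(3))
  have JJ: "J \<circ> (J \<circ> x) = x" for x :: "nat \<Rightarrow> 'h" by (simp add: fun_eq_iff J(4))
  have map: "matrix_mapping_on smul l2_sum E" and img: "matrix_apply smul E ` l2_sum = l2_sum"
    using E by (auto simp: surjective_matrix_mapping_on_def)
  note conj = conj_matrix_mapping[OF J map]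
  have "y \<in> matrix_apply smul (conj_matrix E) ` l2_sum" if y: "y \<in> l2_sum" for y
  proof -
    obtain x where x: "x \<in> l2_sum" "matrix_apply smul E x = J \<circ> y"
      using img l2[OF y] by (metis imageE)
    have "matrix_apply smul (conj_matrix E) (J \<circ> x) = y"
      by (simp only: conj(2)[OF l2[OF x(1)]] JJ x(2))
    then show ?thesis using l2[OF x(1)] by blast
  qed
  with conj(1) show ?thesis
    by (auto simp: surjective_matrix_mapping_on_def matrix_mapping_on_def)
qed

end

theorem theorem2p12:
  fixes smul :: "'k::real_or_complex \<Rightarrow> 'h::banach \<Rightarrow> 'h"
    and ip :: "'h \<Rightarrow> 'h \<Rightarrow> 'k"
    and E :: "'k inf_matrix"
  assumes "hilbert_space smul ip"
    and "separable_space (euclidean :: 'h topology)"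
    and "matrix_mapping_on smul l2_sum E"
  shows "matrix_mapping_on smul l2_sum (conj_matrix E) \<and>
    (invertible_matrix E \<longrightarrow> invertible_matrix (conj_matrix E)) \<and>
    (surjective_matrix_mapping_on smul l2_sum E \<longrightarrow>
       surjective_matrix_mapping_on smul l2_sum (conj_matrix E))"
proof -
  interpret hilbert_space smul ip by fact
  obtain J where "bounded_linear J" "\<And>a x. J (smul a x) = smul (sconj a) (J x)"
    "\<And>x. norm (J x) = norm x" "\<And>x. J (J x) = x"
    by (rule conjugation_exists) blast
  note J = this
  show ?thesis
    using conj_matrix_mapping(1)[OF J assms(3)] invertible_conj_matrix
      surjective_conj_matrix_mapping[OF J] by blast
qed

end
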